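(* Let $\mathsf{X}_1,\dots,\mathsf{X}_d$ be $k$-planes in $\mathbb{R}^n$ with orthonormal bases given by the columns of $X_1,\dots,X_d\in\mathbb{R}^{n\times k}$, and let $X=[X_1,\dots,X_d]\in\mathbb{R}^{n\times kd}$ be the matrix obtained by concatenating the $X_i$. Let $p$ be an integer with $1\le p\le n-k$. (a) A matrix $W\in\mathbb{R}^{n\times p}$ with orthonormal columns, with column space $\mathsf{W}$, minimizes the sum of squared chordal distances $\sum_{i=1}^d d_c(\mathsf{X}_i,\mathsf{W})^2$ precisely when, up to right multiplication by an orthogonal $p\times p$ matrix, $W$ is a matrix of (orthonormal) right singular vectors of $X^{\mathsf T}$ corresponding to its $p$ smallest singular values. (b) For such $W$, the chordal distance $\big(\sum_{i=1}^d d_c(\mathsf{X}_i,\mathsf{W})^2\big)^{1/2}$ of the data to $\mathsf{W}$ is the 2-norm of the vector of the $p$ smallest singular values of $X^{\mathsf T}$. (c) The best approximations are nested: fixing an orthonormal basis of right singular vectors of $X^{\mathsf T}$ ordered by singular value, for $k\le p'\le q'\le n$ the best approximating $G(k,p')$ (the set of $k$-planes orthogonal to the $n-p'$ right singular vectors with smallest singular values) is contained in the best approximating $G(k,q')$ (the set of $k$-planes orthogonal to the $n-q'$ right singular vectors with smallest singular values).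
   Context: $G(k,n)$ is the Grassmannian of $k$-dimensional subspaces of $\mathbb{R}^n$. For $\mathsf{X},\mathsf{Y}\in G(k,n)$ with orthonormal basis matrices $X,Y\in\mathbb{R}^{n\times k}$, the principal angles $\theta_1,\dots,\theta_k\in[0,\pi/2]$ are defined by $\cos\theta_i=\sigma_i(X^{\mathsf T}Y)$ (singular values), and the chordal distance is $d_c(\mathsf{X},\mathsf{Y})=\big(\sum_i\sin^2\theta_i\big)^{1/2}$. For a subspace $\mathsf{W}\subset\mathbb{R}^n$ of dimension $n-m\le n-k$, the set of $k$-planes orthogonal to $\mathsf{W}$ is a copy of $G(k,m)$ in $G(k,n)$, and $d_c(\mathsf{X},\mathsf{W})$ denotes the minimum of $d_c(\mathsf{X},\mathsf{Y})$ over all $k$-planes $\mathsf{Y}$ orthogonal to $\mathsf{W}$. The right singular vectors of $X^{\mathsf T}$ are an orthonormal basis of $\mathbb{R}^n$ of eigenvectors of $XX^{\mathsf T}$, with singular values the square roots of the $n$ eigenvalues counted with multiplicity (zeros included); in case of ties any choice of singular vectors is allowed. *)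

theory Defs
  imports "HOL-Analysis.Analysis" "HOL-Computational_Algebra.Polynomial"
begin

section \<open>Singular values and right singular vectors\<close>

definition charpoly :: "real^'n^'n \<Rightarrow> real poly" where
  "charpoly A = det (mat [:0, 1:] - map_matrix (\<lambda>a. [:a:]) A)"

text \<open>For an \<open>m \<times> n\<close> matrix there are \<open>n\<close> singular values (zeros included), one for each eigenvalue
  of \<open>A\<^sup>T A\<close> counted with algebraic multiplicity.\<close>

definition singular_values :: "real^'n^'m \<Rightarrow> real multiset" where
  "singular_values A = image_mset sqrt (proots (charpoly (transpose A ** A)))"

text \<open>The singular values in increasing order, so that position 0 holds the smallest one.\<close>

definition sorted_singular_values :: "real^'n^'m \<Rightarrow> real list" where
  "sorted_singular_values A = sorted_list_of_multiset (singular_values A)"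

definition ordered_right_singular_basis :: "real^'n^'m \<Rightarrow> (real^'n) list \<Rightarrow> bool" where
  "ordered_right_singular_basis A vs \<longleftrightarrow>
     length vs = CARD('n) \<and>
     (\<forall>i<CARD('n). \<forall>j<CARD('n). vs ! i \<bullet> vs ! j = (if i = j then 1 else 0)) \<and>
     (\<forall>i<CARD('n). (transpose A ** A) *v (vs ! i) = (sorted_singular_values A ! i)\<^sup>2 *\<^sub>R (vs ! i))"

text \<open>The index type \<open>'p\<close> carries no order, so the columns of \<open>V\<close> are matched with the first
  \<open>CARD('p)\<close> vectors of the basis by an arbitrary bijection.\<close>

definition smallest_right_singular_matrix :: "real^'n^'m \<Rightarrow> real^'p^'n \<Rightarrow> bool" where
  "smallest_right_singular_matrix A V \<longleftrightarrow>
     (\<exists>vs f. ordered_right_singular_basis A vs \<and>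
             bij_betw f (UNIV :: 'p set) {..<CARD('p)} \<and>
             (\<forall>j. column j V = vs ! f j))"

section \<open>Grassmannians and chordal distance\<close>

definition grassmannian :: "nat \<Rightarrow> (real^'n) set set" where
  "grassmannian k = {S. subspace S \<and> dim S = k}"

definition orthonormal_columns :: "real^'k^'n \<Rightarrow> bool" where
  "orthonormal_columns X \<longleftrightarrow> transpose X ** X = mat 1"

definition column_space :: "real^'k^'n \<Rightarrow> (real^'n) set" where
  "column_space X = span (columns X)"

definition orthonormal_basis_matrix :: "(real^'n) set \<Rightarrow> real^'k^'n \<Rightarrow> bool" where
  "orthonormal_basis_matrix S X \<longleftrightarrow> orthonormal_columns X \<and> column_space X = S"

definition principal_angles :: "real^'k^'n \<Rightarrow> real^'k^'n \<Rightarrow> real multiset" where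
  "principal_angles X Y = image_mset arccos (singular_values (transpose X ** Y))"

definition chordal_dist_matrix :: "real^'k^'n \<Rightarrow> real^'k^'n \<Rightarrow> real" where
  "chordal_dist_matrix X Y = sqrt (\<Sum>\<theta>\<in>#principal_angles X Y. (sin \<theta>)\<^sup>2)"

text \<open>The type argument supplies the dimension \<open>k = CARD('k)\<close> of the planes. The value does not
  depend on the chosen bases; this is \<open>chordal_dist_eq\<close> below.\<close>

definition chordal_dist :: "'k::finite itself \<Rightarrow> (real^'n) set \<Rightarrow> (real^'n) set \<Rightarrow> real" where
  "chordal_dist K S T =
     chordal_dist_matrix (SOME X :: real^'k^'n. orthonormal_basis_matrix S X)
                         (SOME Y :: real^'k^'n. orthonormal_basis_matrix T Y)"

definition planes_orthogonal_to :: "nat \<Rightarrow> (real^'n) set \<Rightarrow> (real^'n) set set" where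
  "planes_orthogonal_to k W = {Y \<in> grassmannian k. Y \<subseteq> W\<^sup>\<bottom>}"

definition chordal_dist_to_complement ::
  "'k::finite itself \<Rightarrow> (real^'n) set \<Rightarrow> (real^'n) set \<Rightarrow> real" where
  "chordal_dist_to_complement K S W =
     (LEAST r. \<exists>Y \<in> planes_orthogonal_to CARD('k) W. r = chordal_dist K S Y)"

definition sum_sq_chordal_dist ::
  "'k::finite itself \<Rightarrow> ('d::finite \<Rightarrow> (real^'n) set) \<Rightarrow> (real^'n) set \<Rightarrow> real" where
  "sum_sq_chordal_dist K S W = (\<Sum>i\<in>UNIV. (chordal_dist_to_complement K (S i) W)\<^sup>2)"

definition concat_matrices :: "('d::finite \<Rightarrow> real^'k^'n) \<Rightarrow> real^('d \<times> 'k)^'n" where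
  "concat_matrices X = (\<chi> r c. X (fst c) $ r $ snd c)"

section \<open>Independence of the chordal distance from the chosen bases\<close>

lemma charpoly_similar:
  fixes A B C :: "real^'n^'n"
  assumes "B ** C = mat 1"
  shows "charpoly (B ** A ** C) = charpoly A"
proof -
  let ?c = "\<lambda>M::real^'n^'n. map_matrix (\<lambda>a. [:a:]) M"
  let ?x = "mat [:0, 1:] :: real poly^'n^'n"
  have const_sum: "[:sum f S:] = (\<Sum>k\<in>S. [:f k:])" for f :: "'n \<Rightarrow> real" and S
    by (rule poly_eqI) (simp add: coeff_sum coeff_pCons split: nat.splits)
  have mul: "?c (M ** N) = ?c M ** ?c N" for M N
    by (simp add: vec_eq_iff matrix_matrix_mult_def const_sum mult.commute)
  have one: "?c (mat 1) = mat 1"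
    by (simp add: vec_eq_iff mat_def)
  have BC: "?c B ** ?c C = mat 1"
    by (metis mul one assms)
  have comm: "?c B ** ?x = ?x ** ?c B"
    by (simp add: vec_eq_iff matrix_matrix_mult_def mat_def if_distrib if_distribR cong: if_cong)
  have diff_left: "U ** (V - W) = U ** V - U ** W" for U V W :: "real poly^'n^'n"
    by (simp add: vec_eq_iff matrix_matrix_mult_def right_diff_distrib sum_subtractf)
  have diff_right: "(U - V) ** W = U ** W - V ** W" for U V W :: "real poly^'n^'n"
    by (simp add: vec_eq_iff matrix_matrix_mult_def left_diff_distrib sum_subtractf)
  have "?c B ** (?x - ?c A) ** ?c C = ?c B ** ?x ** ?c C - ?c B ** ?c A ** ?c C"
    by (simp only: diff_left diff_right)
  also have "?c B ** ?x ** ?c C = ?x"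
    by (metis comm BC matrix_mul_assoc matrix_mul_rid)
  finally have "?x - ?c (B ** A ** C) = ?c B ** (?x - ?c A) ** ?c C"
    by (simp add: mul)
  moreover have "det (?c B) * det (?c C) = 1"
    using BC by (metis det_I det_mul)
  ultimately show ?thesis
    by (simp add: charpoly_def det_mul mult.commute mult.left_commute)
qed

lemma singular_values_orthogonal_invariant:
  fixes A :: "real^'n^'m" and Q :: "real^'m^'m" and R :: "real^'n^'n"
  assumes "orthogonal_matrix Q" "orthogonal_matrix R"
  shows "singular_values (transpose Q ** A ** R) = singular_values A"
proof -
  have "transpose (transpose Q ** A ** R) ** (transpose Q ** A ** R)
      = transpose R ** transpose A ** (Q ** transpose Q) ** A ** R"
    by (simp add: matrix_transpose_mul matrix_mul_assoc)
  also have "\<dots> = transpose R ** (transpose A ** A) ** R"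
    using assms(1) by (simp add: orthogonal_matrix_def matrix_mul_assoc)
  finally show ?thesis
    using assms(2) by (simp add: singular_values_def charpoly_similar orthogonal_matrix_def)
qed

lemma orthonormal_basis_change:
  fixes X X' :: "real^'k^'n"
  assumes "orthonormal_basis_matrix S X" "orthonormal_basis_matrix S X'"
  obtains Q where "orthogonal_matrix Q" "X' = X ** Q"
proof
  define Q where "Q = transpose X ** X'"
  have fix_col: "(X ** transpose X) *v v = v" if "v \<in> column_space X" for v
    using that unfolding column_space_def
  proof (induction rule: span_induct_alt)
    case base
    show ?case by simp
  next
    case (step c x y)
    then obtain j where "x = column j X"
      by (auto simp: columns_def)
    then have x: "x = X *v axis j 1"
      by (simp add: matrix_vector_mult_basis)
    have "(X ** transpose X) *v x = (X ** (transpose X ** X)) *v axis j 1"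
      by (simp add: x matrix_vector_mul_assoc matrix_mul_assoc)
    then have "(X ** transpose X) *v x = x"
      using assms(1) x by (simp add: orthonormal_basis_matrix_def orthonormal_columns_def)
    then show ?case
      using step by (simp add: matrix_vector_right_distrib scalar_mult_eq_scaleR[symmetric]
          vector_scalar_commute)
  qed
  have "X ** Q *v axis j 1 = X' *v axis j 1" for j
  proof -
    have "column j X' \<in> column_space X"
      using assms unfolding orthonormal_basis_matrix_def column_space_def columns_def
      by (metis (mono_tags, lifting) UNIV_I mem_Collect_eq span_base)
    from fix_col[OF this] show ?thesis
      unfolding Q_def matrix_vector_mult_basis[symmetric]
      by (simp only: matrix_mul_assoc matrix_vector_mul_assoc)
  qed
  then show eq: "X' = X ** Q"
    by (simp add: matrix_vector_mult_basis column_def vec_eq_iff)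
  have "transpose Q ** Q = transpose Q ** (transpose X ** X) ** Q"
    using assms(1) by (simp add: orthonormal_basis_matrix_def orthonormal_columns_def)
  also have "\<dots> = transpose X' ** X'"
    by (simp add: eq matrix_transpose_mul matrix_mul_assoc)
  also have "\<dots> = mat 1"
    using assms(2) by (simp add: orthonormal_basis_matrix_def orthonormal_columns_def)
  finally show "orthogonal_matrix Q"
    by (simp add: orthogonal_matrix)
qed

lemma chordal_dist_eq:
  fixes X Y :: "real^'k^'n"
  assumes "orthonormal_basis_matrix S X" "orthonormal_basis_matrix T Y"
  shows "chordal_dist TYPE('k) S T = chordal_dist_matrix X Y"
proof -
  define X' Y' where "X' = (SOME X :: real^'k^'n. orthonormal_basis_matrix S X)"
    and "Y' = (SOME Y :: real^'k^'n. orthonormal_basis_matrix T Y)"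
  have "orthonormal_basis_matrix S X'" "orthonormal_basis_matrix T Y'"
    unfolding X'_def Y'_def using assms by (metis someI_ex)+
  then obtain Q R where "orthogonal_matrix Q" "X' = X ** Q" "orthogonal_matrix R" "Y' = Y ** R"
    using assms by (metis orthonormal_basis_change)
  then have "singular_values (transpose X' ** Y') = singular_values (transpose X ** Y)"
    using singular_values_orthogonal_invariant[of Q R "transpose X ** Y"]
    by (simp add: matrix_transpose_mul matrix_mul_assoc)
  then show ?thesis
    by (simp add: chordal_dist_def chordal_dist_matrix_def principal_angles_def X'_def Y'_def)
qed

end

theory Submission
  imports Defs
begin

text \<open>Write \<open>A = X\<^sup>T\<close>, where \<open>X\<close> is the concatenated matrix. The theorem reduces to a statement about the
  single function \<open>w \<mapsto> \<parallel>A w\<parallel>\<^sup>2\<close>: for every subspace \<open>W\<close> of dimension at most \<open>n - k\<close> and every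
  orthonormal basis \<open>C\<close> of \<open>W\<close>,
  \<open>\<Sum>\<^sub>i d\<^sub>c(X\<^sub>i, W)\<^sup>2 = \<Sum>\<^sub>w\<^sub>\<in>\<^sub>C \<parallel>A w\<parallel>\<^sup>2\<close> (\<open>sum_sq_chordal_dist_eq\<close>).

  For the reduction, the singular values \<open>\<sigma>\<close> of \<open>X\<^sub>i\<^sup>T Y\<close> lie in \<open>[0,1]\<close>, so that
  \<open>\<Sum> sin\<^sup>2(arccos \<sigma>) = k - \<parallel>X\<^sub>i\<^sup>T Y\<parallel>\<^sub>F\<^sup>2\<close> (\<open>chordal_dist_matrix_eq\<close>). If \<open>Y\<close> is orthogonal to \<open>W\<close>, a basis
  of \<open>W\<close> and the columns of \<open>Y\<close> form an orthonormal system, and Bessel's inequality for the columns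
  of \<open>X\<^sub>i\<close> bounds this below by \<open>\<Sum>\<^sub>w \<parallel>X\<^sub>i\<^sup>T w\<parallel>\<^sup>2\<close>. Equality holds as soon as \<open>Y\<close> contains the
  projections of the columns of \<open>X\<^sub>i\<close> to the complement of \<open>W\<close>; there are \<open>k\<close> of them and the
  complement has dimension at least \<open>k\<close>, so such a \<open>Y\<close> exists (\<open>plane_capturing_vectors\<close>).

  What remains is to minimize \<open>\<Sum>\<^sub>w\<^sub>\<in>\<^sub>C \<parallel>A w\<parallel>\<^sup>2\<close> over subspaces of a fixed dimension \<open>p\<close>. Expanding in a
  singular basis gives the Ky Fan inequality (\<open>ky_fan_inequality\<close>): nothing beats the span of \<open>p\<close>
  basis vectors with the smallest singular values. Conversely, let \<open>W\<close> be a minimizer, with unit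
  vectors \<open>w \<in> W\<close> and \<open>u \<in> W\<^sup>\<bottom>\<close>. Replacing \<open>w\<close> by \<open>u\<close> shows \<open>\<parallel>A w\<parallel> \<le> \<parallel>A u\<parallel>\<close>, and replacing \<open>w\<close> by the
  normalized \<open>w + t u\<close> for small \<open>t\<close> shows that \<open>A w\<close> and \<open>A u\<close> are orthogonal
  (\<open>minimizer_splits_singular_space\<close>). Singular bases of \<open>W\<close> and of \<open>W\<^sup>\<bottom>\<close>, each sorted and then
  concatenated, therefore form an ordered basis of right singular vectors whose first \<open>p\<close>
  members span \<open>W\<close>. This choice of basis adapts to \<open>W\<close>, so ties between singular values are covered.
  The minimal value is the sum of the \<open>p\<close> smallest squared singular values, and the optimal spans
  for different \<open>p\<close> are nested because they come from initial segments of one ordered basis.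

  Right singular vectors of \<open>A\<close> are used throughout in the form of orthonormal bases that \<open>A\<close> maps to
  pairwise orthogonal vectors, the singular values being the lengths of the images. The same
  variational argument with \<open>p = 1\<close> produces such bases (\<open>singular_basis_exists\<close>), and computing the
  characteristic polynomial of \<open>A\<^sup>T A\<close> in such a basis identifies the singular values
  (\<open>singular_values_eq\<close>).\<close>

section \<open>Orthonormal bases of subspaces\<close>

definition orthonormal_basis :: "'a::euclidean_space set \<Rightarrow> 'a set \<Rightarrow> bool" where
  "orthonormal_basis W B \<longleftrightarrow> pairwise orthogonal B \<and> (\<forall>b\<in>B. norm b = 1) \<and> span B = W"

lemma orthonormal_independent:
  fixes B :: "'a::euclidean_space set"
  assumes "pairwise orthogonal B" "\<And>b. b \<in> B \<Longrightarrow> norm b = 1"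
  shows "independent B"
  using assms by (intro pairwise_orthogonal_independent) force+

lemma orthonormal_basisD:
  assumes "orthonormal_basis W B"
  shows "finite B" "card B = dim W" "subspace W" "B \<subseteq> W"
    and "\<And>b. b \<in> B \<Longrightarrow> norm b = 1"
    and "\<And>b c. b \<in> B \<Longrightarrow> c \<in> B \<Longrightarrow> b \<noteq> c \<Longrightarrow> b \<bullet> c = 0"
proof -
  have "independent B"
    using assms by (intro orthonormal_independent) (auto simp: orthonormal_basis_def)
  then show "finite B" "card B = dim W"
    using assms by (auto simp: orthonormal_basis_def independent_imp_finite dim_eq_card_independent)
  show "subspace W" "B \<subseteq> W" "\<And>b. b \<in> B \<Longrightarrow> norm b = 1"
    "\<And>b c. b \<in> B \<Longrightarrow> c \<in> B \<Longrightarrow> b \<noteq> c \<Longrightarrow> b \<bullet> c = 0"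
    using assms by (auto simp: orthonormal_basis_def span_base pairwise_def orthogonal_def)
qed

lemma orthonormal_basisI_card:
  fixes U :: "'a::euclidean_space set"
  assumes "subspace U" "B \<subseteq> U" "card B = dim U"
    and "pairwise orthogonal B" "\<And>b. b \<in> B \<Longrightarrow> norm b = 1"
  shows "orthonormal_basis U B"
proof -
  have "independent B" using assms by (intro orthonormal_independent)
  then have "U \<subseteq> span B"
    using assms by (intro card_ge_dim_independent) auto
  then show ?thesis
    using assms span_minimal[of B U] by (auto simp: orthonormal_basis_def)
qed

lemma orthonormal_basis_exists:
  fixes W :: "'a::euclidean_space set"
  assumes "subspace W"
  obtains B where "orthonormal_basis W B"
  using orthonormal_basis_subspace[OF assms] unfolding orthonormal_basis_def by metis

lemma dim_orthogonal_comp_within: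
  fixes U V :: "'a::euclidean_space set"
  assumes "subspace U" "subspace V" "V \<subseteq> U"
  shows "dim V + dim (U \<inter> V\<^sup>\<bottom>) = dim U"
proof -
  have "U \<inter> V\<^sup>\<bottom> = {y \<in> U. \<forall>x\<in>V. orthogonal x y}"
    by (auto simp: orthogonal_comp_def)
  then show ?thesis
    using dim_subspace_orthogonal_to_vectors[OF assms(2,1,3)] by simp
qed

lemma orthogonal_comp_inner: "x \<in> V \<Longrightarrow> y \<in> V\<^sup>\<bottom> \<Longrightarrow> x \<bullet> y = 0"
  by (auto simp: orthogonal_comp_def orthogonal_def)

lemma orthonormal_basis_span_subset:
  assumes "orthonormal_basis V B" "C \<subseteq> B"
  shows "orthonormal_basis (span C) C"
  using assms by (auto simp: orthonormal_basis_def intro: pairwise_mono)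

lemma orthonormal_basis_Un:
  assumes B: "orthonormal_basis V B" and C: "orthonormal_basis T C" and T: "T \<subseteq> V\<^sup>\<bottom>"
  shows "orthonormal_basis (span (B \<union> C)) (B \<union> C)" and "B \<inter> C = {}"
proof -
  have 0: "b \<bullet> c = 0" if "b \<in> B" "c \<in> C" for b c
    using orthonormal_basisD(4)[OF B] orthonormal_basisD(4)[OF C] that T
    by (blast intro: orthogonal_comp_inner)
  show "B \<inter> C = {}"
    using 0 orthonormal_basisD(5)[OF B] by (force simp: disjoint_iff)
  show "orthonormal_basis (span (B \<union> C)) (B \<union> C)"
    using B C 0 0[THEN trans[OF inner_commute]]
    by (auto simp: orthonormal_basis_def pairwise_def orthogonal_def)
qed

text \<open>An orthonormal basis of \<open>V\<close> completed by one of its relative complement: \<open>B \<union> C\<close> spans \<open>U\<close> because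
  it is an orthonormal system of the right cardinality.\<close>

lemma orthonormal_basis_Un_comp:
  fixes U V :: "'a::euclidean_space set"
  assumes "subspace U" "V \<subseteq> U" and B: "orthonormal_basis V B"
    and C: "orthonormal_basis (U \<inter> V\<^sup>\<bottom>) C"
  shows "orthonormal_basis U (B \<union> C)"
proof (rule orthonormal_basisI_card)
  note Un = orthonormal_basis_Un[OF B C]
  show "card (B \<union> C) = dim U"
    using Un(2) dim_orthogonal_comp_within[OF assms(1) _ assms(2)]
      orthonormal_basisD(1-3)[OF B] orthonormal_basisD(1-3)[OF C]
    by (simp add: card_Un_disjoint)
  show "B \<union> C \<subseteq> U"
    using orthonormal_basisD(4)[OF B] orthonormal_basisD(4)[OF C] assms(2) by blast
  show "pairwise orthogonal (B \<union> C)" "\<And>b. b \<in> B \<union> C \<Longrightarrow> norm b = 1"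
    using Un(1) by (auto simp: orthonormal_basis_def)
qed fact

lemma parseval:
  assumes B: "orthonormal_basis W B" and "x \<in> W"
  shows "(\<Sum>b\<in>B. (x \<bullet> b)\<^sup>2) = (norm x)\<^sup>2"
proof -
  have "x = (\<Sum>b\<in>B. (x \<bullet> b) *\<^sub>R b)"
    using orthonormal_basis_expand[of B x] assms orthonormal_basisD[OF B]
    by (simp add: orthonormal_basis_def inner_commute)
  then have "x \<bullet> x = x \<bullet> (\<Sum>b\<in>B. (x \<bullet> b) *\<^sub>R b)" by simp
  also have "\<dots> = (\<Sum>b\<in>B. (x \<bullet> b)\<^sup>2)"
    by (simp add: inner_sum_right power2_eq_square)
  finally show ?thesis by (simp add: power2_norm_eq_inner)
qed

lemma bessel:
  assumes B: "orthonormal_basis W B"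
  shows "(\<Sum>b\<in>B. (x \<bullet> b)\<^sup>2) \<le> (norm x)\<^sup>2"
proof -
  obtain C where C: "orthonormal_basis (UNIV \<inter> W\<^sup>\<bottom>) C"
    using subspace_orthogonal_comp orthonormal_basis_exists by (metis inf_top_left)
  have BC: "orthonormal_basis UNIV (B \<union> C)"
    by (intro orthonormal_basis_Un_comp[OF _ _ B C]) auto
  have "(\<Sum>b\<in>B. (x \<bullet> b)\<^sup>2) \<le> (\<Sum>b\<in>B\<union>C. (x \<bullet> b)\<^sup>2)"
    using orthonormal_basisD(1)[OF BC] by (intro sum_mono2) auto
  then show ?thesis using parseval[OF BC] by simp
qed

lemma orthonormal_basis_insert:
  assumes B: "orthonormal_basis V B" and "norm v = 1" and orth: "\<And>b. b \<in> B \<Longrightarrow> b \<bullet> v = 0"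
  shows "orthonormal_basis (span (insert v B)) (insert v B)" "v \<notin> B"
proof -
  show "v \<notin> B" using orth assms(2) by force
  show "orthonormal_basis (span (insert v B)) (insert v B)"
    using assms by (auto simp: orthonormal_basis_def pairwise_def orthogonal_def inner_commute)
qed

lemma orthonormal_basis_containing:
  fixes V :: "'a::euclidean_space set"
  assumes "subspace V" "v \<in> V" "norm v = 1"
    and B: "orthonormal_basis (V \<inter> (span {v})\<^sup>\<bottom>) B"
  shows "orthonormal_basis V (insert v B)" and "\<And>b. b \<in> B \<Longrightarrow> v \<bullet> b = 0"
proof -
  have v: "orthonormal_basis (span {v}) {v}"
    using assms(3) by (auto simp: orthonormal_basis_def)
  have "span {v} \<subseteq> V"
    using assms(1,2) by (simp add: span_minimal)
  from orthonormal_basis_Un_comp[OF assms(1) this v B]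
  show "orthonormal_basis V (insert v B)" by simp
  show "v \<bullet> b = 0" if "b \<in> B" for b
    using orthonormal_basisD(4)[OF B] that orthogonal_comp_inner[of v "span {v}" b]
    by (auto simp: span_base)
qed

section \<open>Bases with pairwise orthogonal images\<close>

text \<open>First-order optimality: \<open>\<parallel>g (v + t u)\<parallel>\<^sup>2 - \<parallel>g v\<parallel>\<^sup>2 \<parallel>v + t u\<parallel>\<^sup>2\<close> is a polynomial in \<open>t\<close> with linear
  coefficient \<open>2 (g v \<bullet> g u)\<close>; it vanishes at \<open>0\<close> and is nonnegative, so this coefficient is zero.\<close>

lemma images_orthogonal_of_stationary:
  fixes g :: "'a::real_inner \<Rightarrow> 'b::real_inner"
  assumes g: "linear g" and v: "norm v = 1" "norm u = 1" "v \<bullet> u = 0"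
    and min: "\<And>t. (norm (g v))\<^sup>2 * (norm (v + t *\<^sub>R u))\<^sup>2 \<le> (norm (g (v + t *\<^sub>R u)))\<^sup>2"
  shows "g v \<bullet> g u = 0"
proof (rule ccontr)
  define b where "b = g v \<bullet> g u"
  define d where "d = (norm (g u))\<^sup>2"
  assume "g v \<bullet> g u \<noteq> 0"
  then have b: "b\<^sup>2 > 0" by (simp add: b_def)
  have d: "d \<ge> 0" by (simp add: d_def)
  have ineq: "0 \<le> 2 * t * b + t\<^sup>2 * (d - (norm (g v))\<^sup>2)" for t
  proof -
    have "(norm (v + t *\<^sub>R u))\<^sup>2 = 1 + t\<^sup>2"
      using v by (simp add: power2_norm_eq_inner inner_add_left inner_add_right
          inner_commute[of u v] norm_eq_1) (simp add: power2_eq_square)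
    moreover have "(norm (g (v + t *\<^sub>R u)))\<^sup>2 = (norm (g v))\<^sup>2 + 2 * t * b + t\<^sup>2 * d"
      by (simp add: linear_add[OF g] linear_scale[OF g] b_def d_def power2_norm_eq_inner
          inner_add_left inner_add_right inner_commute[of "g u" "g v"])
        (simp add: power2_eq_square algebra_simps)
    ultimately show ?thesis using min[of t] by (simp add: algebra_simps)
  qed
  have "0 \<le> 2 * t * b + t\<^sup>2 * d" for t
    using ineq[of t] mult_nonneg_nonneg[OF zero_le_power2[of t] zero_le_power2[of "norm (g v)"]]
    unfolding right_diff_distrib by linarith
  define x where "x = b / (d + 1)"
  have x: "b = x * (d + 1)" using d by (simp add: x_def)
  \<comment> \<open>At \<open>t = - b / (d + 1)\<close> the linear term dominates the quadratic one.\<close>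
  have "0 \<le> 2 * (- x) * b + (- x)\<^sup>2 * d" by fact
  also have "\<dots> = - (x\<^sup>2 * (d + 2))"
    unfolding x by (simp add: algebra_simps power2_eq_square)
  finally show False using b d x by (simp add: mult_le_0_iff)
qed

text \<open>Existence of right singular vectors. A unit vector \<open>v\<close> of \<open>V\<close> minimizing \<open>\<parallel>g v\<parallel>\<close> exists by
  compactness, and stationarity makes \<open>g v\<close> orthogonal to the images of all vectors of \<open>V\<close> that are
  orthogonal to \<open>v\<close>; the remaining basis vectors come from that smaller subspace. Asking for orthogonal
  images instead of eigenvectors of \<open>g\<^sup>T g\<close> gives the statement a meaning for any subspace \<open>V\<close>, in
  particular for a minimizing subspace before it is known to be spanned by eigenvectors.\<close>

lemma singular_basis_exists:
  fixes g :: "'a::euclidean_space \<Rightarrow> 'b::euclidean_space"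
  assumes g: "linear g"
  shows "subspace V \<Longrightarrow> \<exists>B. orthonormal_basis V B \<and> pairwise (\<lambda>b c. g b \<bullet> g c = 0) B"
proof (induction "dim V" arbitrary: V)
  case 0
  then have "V = {0}" using subspace_0 by fastforce
  then have "orthonormal_basis V {}" by (simp add: orthonormal_basis_def)
  then show ?case by (intro exI[of _ "{}"]) auto
next
  case (Suc n)
  let ?K = "V \<inter> sphere 0 1"
  obtain v where v: "v \<in> V" "norm v = 1"
    and vmin: "\<And>z. z \<in> V \<Longrightarrow> norm z = 1 \<Longrightarrow> norm (g v) \<le> norm (g z)"
  proof -
    have "compact ?K"
      using Suc.prems by (intro closed_Int_compact closed_subspace) auto
    moreover have "?K \<noteq> {}"
    proof -
      obtain B where B: "orthonormal_basis V B" using orthonormal_basis_exists Suc.prems by blast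
      have "B \<noteq> {}" using Suc.hyps(2) orthonormal_basisD(2)[OF B]
        by (metis card.empty nat.distinct(1))
      then obtain b where "b \<in> B" by blast
      then show ?thesis using orthonormal_basisD(4,5)[OF B] by fastforce
    qed
    moreover have "continuous_on ?K (\<lambda>z. norm (g z))"
      using g by (intro continuous_on_norm linear_continuous_on)
        (simp add: linear_conv_bounded_linear)
    ultimately show thesis
      using continuous_attains_inf[of ?K "\<lambda>z. norm (g z)"] that
      by (metis IntE IntI mem_sphere_0)
  qed
  have vmin': "(norm (g v))\<^sup>2 * (norm z)\<^sup>2 \<le> (norm (g z))\<^sup>2" if "z \<in> V" for z
  proof (cases "z = 0")
    case False
    have "norm (g v) \<le> norm (g (z /\<^sub>R norm z))"
      using that False Suc.prems by (intro vmin) (auto simp: subspace_scale)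
    then have "norm (g v) * norm z \<le> norm (g z)"
      using False by (simp add: linear_scale[OF g] field_simps)
    then show ?thesis
      unfolding power_mult_distrib[symmetric] by (intro power_mono) auto
  qed simp
  let ?V' = "V \<inter> (span {v})\<^sup>\<bottom>"
  have sub: "subspace ?V'"
    using Suc.prems by (intro subspace_inter subspace_orthogonal_comp)
  have "dim (span {v}) = 1"
    using v(2) by (subst dim_span, subst dim_eq_card_independent) (auto simp: dependent_single)
  then have "dim ?V' = n"
    using dim_orthogonal_comp_within[OF Suc.prems, of "span {v}"] Suc.hyps(2) v Suc.prems
    by (simp add: span_minimal)
  then obtain B where B: "orthonormal_basis ?V' B" "pairwise (\<lambda>b c. g b \<bullet> g c = 0) B"
    using Suc.hyps(1)[of ?V'] sub by auto
  note B' = orthonormal_basis_containing[OF Suc.prems v B(1)]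
  have "g v \<bullet> g b = 0" if "b \<in> B" for b
  proof (rule images_orthogonal_of_stationary[OF g v(2)])
    have "b \<in> V" using orthonormal_basisD(4)[OF B(1)] that by auto
    then show "(norm (g v))\<^sup>2 * (norm (v + t *\<^sub>R b))\<^sup>2 \<le> (norm (g (v + t *\<^sub>R b)))\<^sup>2" for t
      using v Suc.prems by (intro vmin') (auto simp: subspace_add subspace_scale)
  qed (use B' orthonormal_basisD(5)[OF B(1)] that in auto)
  then have "pairwise (\<lambda>b c. g b \<bullet> g c = 0) (insert v B)"
    using B(2) by (auto simp: pairwise_insert inner_commute)
  then show ?case using B'(1) by blast
qed

lemma singular_basis_norm_sq:
  fixes g :: "'a::euclidean_space \<Rightarrow> 'b::real_inner"
  assumes g: "linear g" and B: "orthonormal_basis UNIV B" "pairwise (\<lambda>b c. g b \<bullet> g c = 0) B"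
  shows "(norm (g x))\<^sup>2 = (\<Sum>b\<in>B. (x \<bullet> b)\<^sup>2 * (norm (g b))\<^sup>2)"
proof -
  note BD = orthonormal_basisD[OF B(1)]
  have "x = (\<Sum>b\<in>B. (x \<bullet> b) *\<^sub>R b)"
    using orthonormal_basis_expand[of B x] B BD by (simp add: orthonormal_basis_def inner_commute)
  then have "g x = (\<Sum>b\<in>B. (x \<bullet> b) *\<^sub>R g b)"
    by (metis (no_types, lifting) linear_sum[OF g] linear_scale[OF g] sum.cong)
  then have "(norm (g x))\<^sup>2 = (\<Sum>b\<in>B. \<Sum>c\<in>B. ((x \<bullet> b) *\<^sub>R g b) \<bullet> ((x \<bullet> c) *\<^sub>R g c))"
    by (simp only: power2_norm_eq_inner inner_sum_left inner_sum_right) (rule sum.swap)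
  also have "\<dots> = (\<Sum>b\<in>B. \<Sum>c\<in>B. if c = b then (x \<bullet> b)\<^sup>2 * (norm (g b))\<^sup>2 else 0)"
    using B(2) by (intro sum.cong refl) (auto simp: pairwise_def power2_eq_square dot_square_norm)
  finally show ?thesis using BD(1) by simp
qed

section \<open>Minimizing the sum of squared lengths over subspaces\<close>

text \<open>In the basis \<open>L \<union> H\<close> the right-hand side is \<open>\<Sum>\<^sub>b c\<^sub>b \<parallel>g b\<parallel>\<^sup>2\<close> with weights \<open>c\<^sub>b = \<Sum>\<^sub>w (w \<bullet> b)\<^sup>2\<close>. These lie
  in \<open>[0,1]\<close> by Bessel and add up to \<open>card L\<close> by Parseval, so passing to the indicator weights of \<open>L\<close>
  moves mass from \<open>H\<close> to \<open>L\<close>, across a threshold \<open>\<mu>\<close> that separates the two sets of values.\<close>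

lemma ky_fan_inequality:
  fixes g :: "'a::euclidean_space \<Rightarrow> 'b::real_inner"
  assumes g: "linear g" and B: "orthonormal_basis UNIV (L \<union> H)" "pairwise (\<lambda>b c. g b \<bullet> g c = 0) (L \<union> H)"
    and disj: "L \<inter> H = {}" and le: "\<And>l h. l \<in> L \<Longrightarrow> h \<in> H \<Longrightarrow> norm (g l) \<le> norm (g h)"
    and C: "orthonormal_basis W C" and card: "card C = card L"
  shows "(\<Sum>l\<in>L. (norm (g l))\<^sup>2) \<le> (\<Sum>w\<in>C. (norm (g w))\<^sup>2)"
proof -
  define q where "q b = (norm (g b))\<^sup>2" for b
  define c where "c b = (\<Sum>w\<in>C. (w \<bullet> b)\<^sup>2)" for b
  note CD = orthonormal_basisD[OF C] and BD = orthonormal_basisD[OF B(1)]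
  have fin: "finite L" "finite H" using BD(1) by auto
  obtain \<mu> where mu: "\<And>l. l \<in> L \<Longrightarrow> q l \<le> \<mu>" "\<And>h. h \<in> H \<Longrightarrow> \<mu> \<le> q h"
  proof (cases "L = {}")
    case True
    then show thesis using that[of 0] by (auto simp: q_def)
  next
    case False
    then show thesis using that[of "Max (q ` L)"] fin le
      by (auto simp: q_def intro!: power_mono)
  qed
  have c1: "c b \<le> 1" if "b \<in> L \<union> H" for b
    using bessel[OF C, of b] BD(5)[OF that] by (simp add: c_def inner_commute)
  have c0: "0 \<le> c b" for b by (simp add: c_def sum_nonneg)
  have "(\<Sum>b\<in>L \<union> H. c b) = (\<Sum>w\<in>C. \<Sum>b\<in>L \<union> H. (w \<bullet> b)\<^sup>2)"
    unfolding c_def by (rule sum.swap)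
  also have "\<dots> = (\<Sum>w\<in>C. 1)"
    using parseval[OF B(1)] CD(5) by (intro sum.cong) auto
  finally have csum: "(\<Sum>b\<in>L. c b) + (\<Sum>b\<in>H. c b) = card L"
    using fin disj card by (simp add: sum.union_disjoint)
  have "(\<Sum>w\<in>C. q w) = (\<Sum>w\<in>C. \<Sum>b\<in>L \<union> H. (w \<bullet> b)\<^sup>2 * q b)"
    unfolding q_def by (intro sum.cong refl singular_basis_norm_sq g B)
  also have "\<dots> = (\<Sum>b\<in>L \<union> H. c b * q b)"
    unfolding c_def sum_distrib_right by (rule sum.swap)
  also have "\<dots> = (\<Sum>b\<in>L. c b * q b) + (\<Sum>b\<in>H. c b * q b)"
    using fin disj by (simp add: sum.union_disjoint)
  finally have cost: "(\<Sum>w\<in>C. q w) = \<dots>" .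
  have "(\<Sum>b\<in>L. q b) - (\<Sum>b\<in>L. c b * q b) = (\<Sum>b\<in>L. (1 - c b) * q b)"
    by (simp add: left_diff_distrib sum_subtractf)
  also have "\<dots> \<le> (\<Sum>b\<in>L. (1 - c b) * \<mu>)"
    using c1 mu(1) by (intro sum_mono mult_left_mono) auto
  also have "\<dots> = (\<Sum>b\<in>H. c b * \<mu>)"
    using csum by (simp add: sum_distrib_right[symmetric] sum_subtractf)
  also have "\<dots> \<le> (\<Sum>b\<in>H. c b * q b)"
    using c0 mu(2) by (intro sum_mono mult_left_mono) auto
  finally show ?thesis using cost by (simp add: q_def)
qed

text \<open>Exchange argument: \<open>w\<close> is completed by \<open>B\<close> to an orthonormal basis of \<open>W\<close>, and minimality of \<open>W\<close> is
  compared with the subspaces in which \<open>w\<close> is replaced by another vector \<open>z\<close> orthogonal to \<open>B\<close>, first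
  \<open>z = u\<close> and then \<open>z = w + t u\<close>.\<close>

lemma minimizer_splits_singular_space:
  fixes g :: "'a::euclidean_space \<Rightarrow> 'b::real_inner"
  assumes g: "linear g" and W: "subspace W"
    and F: "\<And>V B. dim V = dim W \<Longrightarrow> orthonormal_basis V B \<Longrightarrow> F V = (\<Sum>b\<in>B. (norm (g b))\<^sup>2)"
    and min: "\<And>V. subspace V \<Longrightarrow> dim V = dim W \<Longrightarrow> F W \<le> F V"
    and w: "w \<in> W" "norm w = 1" and u: "u \<in> W\<^sup>\<bottom>" "norm u = 1"
  shows "g w \<bullet> g u = 0" "norm (g w) \<le> norm (g u)"
proof -
  obtain B where B: "orthonormal_basis (W \<inter> (span {w})\<^sup>\<bottom>) B"
    using orthonormal_basis_exists subspace_inter[OF W subspace_orthogonal_comp] by blast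
  note wB = orthonormal_basis_containing[OF W w B] and BD = orthonormal_basisD[OF B]
  have "w \<notin> B" using wB(2)[of w] w(2) by (auto simp: norm_eq_1)
  have exchange: "(norm (g w))\<^sup>2 * (norm z)\<^sup>2 \<le> (norm (g z))\<^sup>2" if z: "\<And>b. b \<in> B \<Longrightarrow> b \<bullet> z = 0" for z
  proof (cases "z = 0")
    case False
    define y where "y = z /\<^sub>R norm z"
    have y: "norm y = 1" "\<And>b. b \<in> B \<Longrightarrow> b \<bullet> y = 0"
      using False z by (auto simp: y_def)
    note yB = orthonormal_basis_insert[OF B y]
    have dim: "dim (span (insert y B)) = dim W"
      using orthonormal_basisD(2)[OF yB(1)] orthonormal_basisD(2)[OF wB(1)] yB(2) \<open>w \<notin> B\<close> BD(1)
      by simp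
    have "(norm (g w))\<^sup>2 + (\<Sum>b\<in>B. (norm (g b))\<^sup>2) = F W"
      using F[OF refl wB(1)] \<open>w \<notin> B\<close> BD(1) by simp
    also have "\<dots> \<le> F (span (insert y B))"
      by (rule min[OF subspace_span dim])
    also have "\<dots> = (norm (g y))\<^sup>2 + (\<Sum>b\<in>B. (norm (g b))\<^sup>2)"
      using F[OF dim yB(1)] yB(2) BD(1) by simp
    finally have "(norm (g w))\<^sup>2 \<le> (norm (g y))\<^sup>2" by simp
    then show ?thesis
      using False by (simp add: y_def linear_scale[OF g] power_mult_distrib field_simps)
  qed simp
  have bu: "b \<bullet> u = 0" if "b \<in> B" for b
    using orthogonal_comp_inner[of b W u] BD(4) that u by auto
  show "norm (g w) \<le> norm (g u)"
    using exchange[of u] bu u by (simp add: abs_le_square_iff[symmetric])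
  show "g w \<bullet> g u = 0"
  proof (rule images_orthogonal_of_stationary[OF g w(2) u(2)])
    show "w \<bullet> u = 0" using w u by (intro orthogonal_comp_inner)
    show "(norm (g w))\<^sup>2 * (norm (w + t *\<^sub>R u))\<^sup>2 \<le> (norm (g (w + t *\<^sub>R u)))\<^sup>2" for t
      using bu wB(2) by (intro exchange) (simp add: inner_add_right inner_commute)
  qed
qed

section \<open>Singular values and ordered right singular bases\<close>

lemma gram_matrix_inner:
  fixes A :: "real^'n^'m"
  shows "((transpose A ** A) *v x) \<bullet> y = (A *v x) \<bullet> (A *v y)"
  by (metis dot_lmul_matrix matrix_vector_mul_assoc transpose_matrix_vector)

text \<open>The orthogonal matrix with columns \<open>B\<close> diagonalizes \<open>A\<^sup>T A\<close>, with the squared lengths of the images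
  on the diagonal, and conjugation preserves the characteristic polynomial.\<close>

lemma singular_values_eq:
  fixes A :: "real^'n^'m"
  assumes B: "orthonormal_basis UNIV B" "pairwise (\<lambda>b c. (A *v b) \<bullet> (A *v c) = 0) B"
  shows "singular_values A = image_mset (\<lambda>b. norm (A *v b)) (mset_set B)"
proof -
  note BD = orthonormal_basisD[OF B(1)]
  have "card (UNIV :: 'n set) = card B" using BD(2) by simp
  then obtain e :: "'n \<Rightarrow> real^'n" where e: "bij_betw e UNIV B"
    using finite_same_card_bij[of "UNIV :: 'n set" B] BD(1) by auto
  then have eB: "e i \<in> B" and e_eq: "e i = e j \<longleftrightarrow> i = j" for i j
    by (auto simp: bij_betw_def inj_eq)
  define U :: "real^'n^'n" where "U = (\<chi> i j. e j $ i)"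
  have col: "U *v axis j 1 = e j" for j
    by (simp add: matrix_vector_mult_basis column_def U_def vec_eq_iff)
  have "(transpose U ** U) $ i $ j = e i \<bullet> e j" for i j
    by (simp add: matrix_matrix_mult_def transpose_def U_def inner_vec_def)
  then have "(transpose U ** U) $ i $ j = mat 1 $ i $ j" for i j
    using BD(5)[OF eB] BD(6)[OF eB eB] e_eq by (simp add: mat_def norm_eq_1)
  then have "transpose U ** U = mat 1"
    unfolding vec_eq_iff by blast
  then have "charpoly (transpose A ** A) = charpoly (transpose U ** (transpose A ** A) ** U)"
    by (simp add: charpoly_similar)
  also have "transpose U ** (transpose A ** A) ** U
      = (\<chi> i j. if i = j then (norm (A *v e j))\<^sup>2 else 0)" (is "_ = ?D")
  proof -
    have "(transpose U ** (transpose A ** A) ** U) $ i $ j = (A *v e i) \<bullet> (A *v e j)" for i j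
    proof -
      have "(transpose U ** (transpose A ** A) ** U) $ i $ j
          = ((transpose (A ** U) ** (A ** U)) *v axis j 1) \<bullet> axis i 1"
        by (simp add: matrix_vector_mult_basis column_def inner_axis matrix_transpose_mul
            matrix_mul_assoc)
      also have "\<dots> = (A *v e j) \<bullet> (A *v e i)"
        unfolding gram_matrix_inner by (simp only: matrix_vector_mul_assoc[symmetric] col)
      finally show ?thesis by (simp add: inner_commute)
    qed
    moreover have "(A *v e i) \<bullet> (A *v e j) = (if i = j then (norm (A *v e j))\<^sup>2 else 0)" for i j
      using B(2) e_eq eB by (simp add: pairwise_def power2_norm_eq_inner)
    ultimately show ?thesis
      unfolding vec_eq_iff by simp
  qed
  also have "charpoly ?D = (\<Prod>j\<in>UNIV. [:- (norm (A *v e j))\<^sup>2, 1:])"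
    unfolding charpoly_def by (subst det_diagonal) (auto simp: mat_def)
  finally have "proots (charpoly (transpose A ** A)) = (\<Sum>j\<in>UNIV. {#(norm (A *v e j))\<^sup>2#})"
    by (simp add: proots_prod)
  also have "\<dots> = image_mset (\<lambda>j. (norm (A *v e j))\<^sup>2) (mset_set UNIV)"
    by (simp add: sum_unfold_sum_mset)
  finally have "singular_values A = image_mset (\<lambda>b. norm (A *v b)) (image_mset e (mset_set UNIV))"
    by (simp add: singular_values_def image_mset.compositionality o_def)
  then show ?thesis
    using e by (simp add: image_mset_mset_set bij_betw_def)
qed

lemma sorted_singular_values_eq:
  fixes A :: "real^'n^'m"
  assumes "distinct vs" "orthonormal_basis UNIV (set vs)"
    "pairwise (\<lambda>b c. (A *v b) \<bullet> (A *v c) = 0) (set vs)" "sorted (map (\<lambda>v. norm (A *v v)) vs)"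
  shows "sorted_singular_values A = map (\<lambda>v. norm (A *v v)) vs"
proof -
  have "singular_values A = mset (map (\<lambda>v. norm (A *v v)) vs)"
    using singular_values_eq[OF assms(2,3)] by (simp add: mset_set_set assms(1))
  then show ?thesis
    unfolding sorted_singular_values_def
    by (simp only: sorted_list_of_multiset_mset sorted_sort_id[OF assms(4)])
qed

text \<open>Since \<open>(A\<^sup>T A v) \<bullet> b = A v \<bullet> A b\<close>, the members of an orthonormal basis are eigenvectors of \<open>A\<^sup>T A\<close> exactly
  when their images are pairwise orthogonal; matching the eigenvalues with the increasing list of
  singular values amounts to the lengths of the images being sorted.\<close>

lemma ordered_right_singular_basis_iff:
  fixes A :: "real^'n^'m"
  shows "ordered_right_singular_basis A vs \<longleftrightarrow>
    distinct vs \<and> orthonormal_basis UNIV (set vs) \<and>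
    pairwise (\<lambda>b c. (A *v b) \<bullet> (A *v c) = 0) (set vs) \<and> sorted (map (\<lambda>v. norm (A *v v)) vs)"
    (is "?L \<longleftrightarrow> ?R")
proof
  let ?s = "sorted_singular_values A"
  assume L: ?L
  then have len: "length vs = CARD('n)"
    and vs: "\<And>i j. i < length vs \<Longrightarrow> j < length vs \<Longrightarrow> vs ! i \<bullet> vs ! j = (if i = j then 1 else 0)"
    and eig: "\<And>i. i < length vs \<Longrightarrow> (transpose A ** A) *v (vs ! i) = (?s ! i)\<^sup>2 *\<^sub>R (vs ! i)"
    by (auto simp: ordered_right_singular_basis_def)
  have dist: "distinct vs"
    unfolding distinct_conv_nth using vs by (metis zero_neq_one)
  have onb: "orthonormal_basis UNIV (set vs)"
  proof (rule orthonormal_basisI_card)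
    show "card (set vs) = dim (UNIV :: (real^'n) set)"
      using dist len by (simp add: distinct_card)
    show "pairwise orthogonal (set vs)" "\<And>b. b \<in> set vs \<Longrightarrow> norm b = 1"
      using vs by (auto simp: pairwise_def in_set_conv_nth orthogonal_def norm_eq_1)
  qed auto
  have images: "(A *v (vs ! i)) \<bullet> (A *v (vs ! j)) = (if i = j then (?s ! i)\<^sup>2 else 0)"
    if "i < length vs" "j < length vs" for i j
    unfolding gram_matrix_inner[symmetric] eig[OF that(1)] using vs[OF that] by simp
  then have orth: "pairwise (\<lambda>b c. (A *v b) \<bullet> (A *v c) = 0) (set vs)"
    by (auto simp: pairwise_def in_set_conv_nth)
  have sv: "singular_values A = mset (map (\<lambda>v. norm (A *v v)) vs)"
    using singular_values_eq[OF onb orth] by (simp add: mset_set_set dist)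
  then have s: "?s = sort (map (\<lambda>v. norm (A *v v)) vs)"
    by (simp only: sorted_singular_values_def sorted_list_of_multiset_mset)
  have "set ?s = (\<lambda>v. norm (A *v v)) ` set vs" "length ?s = length vs"
    by (simp_all add: s)
  then have "?s ! i \<ge> 0" if "i < length vs" for i
    using nth_mem[of i ?s] that by auto
  then have "?s ! i = norm (A *v (vs ! i))" if "i < length vs" for i
    using images[OF that that] that by (simp add: norm_eq_sqrt_inner)
  then have "?s = map (\<lambda>v. norm (A *v v)) vs"
    using \<open>length ?s = length vs\<close> by (intro nth_equalityI) auto
  moreover have "sorted ?s" by (simp add: s)
  ultimately show ?R using dist onb orth by simp
next
  assume R: ?R
  then have dist: "distinct vs" and onb: "orthonormal_basis UNIV (set vs)"
    and orth: "pairwise (\<lambda>b c. (A *v b) \<bullet> (A *v c) = 0) (set vs)"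
    by auto
  note D = orthonormal_basisD[OF onb]
  have s: "sorted_singular_values A = map (\<lambda>v. norm (A *v v)) vs"
    using R by (intro sorted_singular_values_eq) auto
  have len: "length vs = CARD('n)"
    using D(2) distinct_card[OF dist] by simp
  have kron: "vs ! i \<bullet> vs ! j = (if i = j then 1 else 0)" if "i < CARD('n)" "j < CARD('n)" for i j
    using D(5)[of "vs ! i"] D(6)[of "vs ! i" "vs ! j"] that len dist
    by (auto simp: nth_eq_iff_index_eq norm_eq_1)
  have "(transpose A ** A) *v v = (norm (A *v v))\<^sup>2 *\<^sub>R v" if "v \<in> set vs" for v
  proof -
    have "orthogonal ((transpose A ** A) *v v - (norm (A *v v))\<^sup>2 *\<^sub>R v) b" if "b \<in> set vs" for b
      using D(5)[of v] D(6)[of v b] orth \<open>v \<in> set vs\<close> that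
      by (cases "b = v") (auto simp: orthogonal_def inner_diff_left gram_matrix_inner pairwise_def
          norm_eq_1 power2_norm_eq_inner)
    moreover have "(transpose A ** A) *v v - (norm (A *v v))\<^sup>2 *\<^sub>R v \<in> span (set vs)"
      using onb by (simp add: orthonormal_basis_def)
    ultimately have "orthogonal ((transpose A ** A) *v v - (norm (A *v v))\<^sup>2 *\<^sub>R v)
        ((transpose A ** A) *v v - (norm (A *v v))\<^sup>2 *\<^sub>R v)"
      by (rule orthogonal_to_span[rotated])
    then show ?thesis by (simp add: orthogonal_def)
  qed
  then have "(transpose A ** A) *v (vs ! i) = (sorted_singular_values A ! i)\<^sup>2 *\<^sub>R (vs ! i)"
    if "i < CARD('n)" for i
    unfolding s using that len by simp
  with kron len show ?L
    unfolding ordered_right_singular_basis_def by (intro conjI allI impI)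
qed

lemma ordered_right_singular_basisD:
  fixes A :: "real^'n^'m"
  assumes "ordered_right_singular_basis A vs"
  shows "distinct vs" "orthonormal_basis UNIV (set vs)"
    "pairwise (\<lambda>b c. (A *v b) \<bullet> (A *v c) = 0) (set vs)" "sorted (map (\<lambda>v. norm (A *v v)) vs)"
    "length vs = CARD('n)"
  using iffD1[OF ordered_right_singular_basis_iff assms] assms
  unfolding ordered_right_singular_basis_def by blast+

lemma take_singular_basis:
  fixes A :: "real^'n^'m"
  assumes vs: "ordered_right_singular_basis A vs" and p: "p \<le> CARD('n)"
  defines "W \<equiv> span (set (take p vs))"
  shows "orthonormal_basis W (set (take p vs))" "dim W = p"
    and "(\<Sum>b\<in>set (take p vs). (norm (A *v b))\<^sup>2) = (\<Sum>i<p. (sorted_singular_values A ! i)\<^sup>2)"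
proof -
  note R = ordered_right_singular_basisD[OF vs]
  have d: "distinct (take p vs)" using R(1) by simp
  show onb: "orthonormal_basis W (set (take p vs))"
    unfolding W_def by (rule orthonormal_basis_span_subset[OF R(2) set_take_subset])
  show "dim W = p"
    using orthonormal_basisD(2)[OF onb] distinct_card[OF d] R(5) p by simp
  have "(\<Sum>b\<in>set (take p vs). (norm (A *v b))\<^sup>2) = (\<Sum>b\<leftarrow>take p vs. (norm (A *v b))\<^sup>2)"
    using d by (simp add: sum_list_distinct_conv_sum_set)
  also have "\<dots> = (\<Sum>i<p. (norm (A *v (vs ! i)))\<^sup>2)"
    using R(5) p by (simp add: sum_list_sum_nth atLeast0LessThan)
  also have "\<dots> = (\<Sum>i<p. (sorted_singular_values A ! i)\<^sup>2)"
    using R(5) p by (intro sum.cong) (auto simp: sorted_singular_values_eq[OF R(1-4)])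
  finally show "(\<Sum>b\<in>set (take p vs). (norm (A *v b))\<^sup>2) = \<dots>" .
qed

lemma smallest_singular_span_minimal:
  fixes A :: "real^'n^'m"
  assumes vs: "ordered_right_singular_basis A vs" and C: "orthonormal_basis V C"
  shows "(\<Sum>b\<in>set (take (dim V) vs). (norm (A *v b))\<^sup>2) \<le> (\<Sum>b\<in>C. (norm (A *v b))\<^sup>2)"
proof (rule ky_fan_inequality[OF _ _ _ _ _ C])
  let ?p = "dim V"
  note R = ordered_right_singular_basisD[OF vs]
  have p: "?p \<le> CARD('n)" using dim_subset_UNIV_cart by blast
  have split: "set (take ?p vs) \<union> set (drop ?p vs) = set vs"
    by (metis append_take_drop_id set_append)
  show "linear ((*v) A)" by simp
  show "orthonormal_basis UNIV (set (take ?p vs) \<union> set (drop ?p vs))"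
    "pairwise (\<lambda>b c. (A *v b) \<bullet> (A *v c) = 0) (set (take ?p vs) \<union> set (drop ?p vs))"
    unfolding split by fact+
  show "set (take ?p vs) \<inter> set (drop ?p vs) = {}"
    using R(1) by (simp add: set_take_disj_set_drop_if_distinct)
  have "sorted (map (\<lambda>v. norm (A *v v)) (take ?p vs @ drop ?p vs))" using R(4) by simp
  then show "norm (A *v l) \<le> norm (A *v h)" if "l \<in> set (take ?p vs)" "h \<in> set (drop ?p vs)" for l h
    using that unfolding map_append sorted_append by auto
  show "card C = card (set (take ?p vs))"
    using orthonormal_basisD(2)[OF C] orthonormal_basisD(2)[OF take_singular_basis(1)[OF vs p]]
      take_singular_basis(2)[OF vs p] by simp
qed

lemma sorted_list_of_finite_set:
  fixes f :: "'a \<Rightarrow> 'b::linorder"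
  assumes "finite S"
  obtains xs where "set xs = S" "distinct xs" "sorted (map f xs)"
proof -
  obtain ys where "set ys = S" "distinct ys" using finite_distinct_list[OF assms] by blast
  then show thesis using that[of "sort_key f ys"] by simp
qed

text \<open>Every vector of a singular basis of \<open>W\<close> has an image no longer than, and orthogonal to, that of any
  vector of a singular basis of the complement, so the two sorted bases can be concatenated.\<close>

lemma minimizer_is_smallest_singular_span:
  fixes A :: "real^'n^'m"
  assumes W: "subspace W"
    and F: "\<And>V B. dim V = dim W \<Longrightarrow> orthonormal_basis V B \<Longrightarrow> F V = (\<Sum>b\<in>B. (norm (A *v b))\<^sup>2)"
    and min: "\<And>V. subspace V \<Longrightarrow> dim V = dim W \<Longrightarrow> F W \<le> F V"
  obtains vs where "ordered_right_singular_basis A vs" "W = span (set (take (dim W) vs))"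
proof -
  let ?g = "\<lambda>v. A *v v"
  have lin: "linear ?g" by simp
  note sep = minimizer_splits_singular_space[of ?g W F, OF lin W F min]
  obtain B where B: "orthonormal_basis W B" "pairwise (\<lambda>b c. ?g b \<bullet> ?g c = 0) B"
    using singular_basis_exists[OF lin W] by auto
  obtain C where C: "orthonormal_basis (UNIV \<inter> W\<^sup>\<bottom>) C" "pairwise (\<lambda>b c. ?g b \<bullet> ?g c = 0) C"
    using singular_basis_exists[OF lin subspace_orthogonal_comp, of W] by auto
  note BD = orthonormal_basisD[OF B(1)] and CD = orthonormal_basisD[OF C(1)]
  have sep': "?g b \<bullet> ?g c = 0" "norm (?g b) \<le> norm (?g c)" if "b \<in> B" "c \<in> C" for b c
    using sep[of b c] that BD(4) BD(5)[of b] CD(4) CD(5)[of c] by blast+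
  obtain bs where bs: "set bs = B" "distinct bs" "sorted (map (\<lambda>v. norm (?g v)) bs)"
    using sorted_list_of_finite_set[OF BD(1)] .
  obtain cs where cs: "set cs = C" "distinct cs" "sorted (map (\<lambda>v. norm (?g v)) cs)"
    using sorted_list_of_finite_set[OF CD(1)] .
  have "ordered_right_singular_basis A (bs @ cs)"
    unfolding ordered_right_singular_basis_iff
  proof (intro conjI)
    show "distinct (bs @ cs)"
      using bs cs orthonormal_basis_Un(2)[OF B(1) C(1)] by simp
    show "orthonormal_basis UNIV (set (bs @ cs))"
      using orthonormal_basis_Un_comp[OF _ _ B(1) C(1)] bs cs by simp
    show "pairwise (\<lambda>b c. ?g b \<bullet> ?g c = 0) (set (bs @ cs))"
      using B(2) C(2) sep'(1) sep'(1)[THEN trans[OF inner_commute]] bs cs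
      by (auto simp: pairwise_def)
    show "sorted (map (\<lambda>v. norm (?g v)) (bs @ cs))"
      using bs cs sep'(2) by (auto simp: sorted_append)
  qed
  moreover have "W = span (set (take (dim W) (bs @ cs)))"
    using B(1) BD(2) bs distinct_card[OF bs(2)] by (simp add: orthonormal_basis_def)
  ultimately show thesis by (rule that)
qed

section \<open>Orthonormal column matrices\<close>

lemma orthonormal_columns_inner:
  fixes X :: "real^'k^'n"
  assumes "orthonormal_columns X"
  shows "column i X \<bullet> column j X = (if i = j then 1 else 0)"
proof -
  have "column i X \<bullet> column j X = (transpose X ** X) $ i $ j"
    by (simp add: matrix_matrix_mult_def transpose_def column_def inner_vec_def)
  then show ?thesis using assms by (simp add: orthonormal_columns_def mat_def)
qed

lemma orthonormal_columns_bij: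
  fixes X :: "real^'k^'n"
  assumes "orthonormal_columns X"
  shows "bij_betw (\<lambda>j. column j X) UNIV (columns X)"
  unfolding bij_betw_def columns_def
  using orthonormal_columns_inner[OF assms] by (auto intro!: injI) (metis zero_neq_one)

lemma sum_columns:
  fixes X :: "real^'k^'n"
  assumes "orthonormal_columns X"
  shows "(\<Sum>b\<in>columns X. h b) = (\<Sum>j\<in>UNIV. h (column j X))"
  using sum.reindex_bij_betw[OF orthonormal_columns_bij[OF assms], of h] by simp

lemma orthonormal_basis_columns:
  fixes X :: "real^'k^'n"
  assumes "orthonormal_columns X"
  shows "orthonormal_basis (column_space X) (columns X)" "dim (column_space X) = CARD('k)"
proof -
  show onb: "orthonormal_basis (column_space X) (columns X)"
    using orthonormal_columns_inner[OF assms]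
    by (auto simp: orthonormal_basis_def column_space_def columns_def pairwise_def orthogonal_def
        norm_eq_1)
  show "dim (column_space X) = CARD('k)"
    using bij_betw_same_card[OF orthonormal_columns_bij[OF assms]] orthonormal_basisD(2)[OF onb]
    by simp
qed

lemma matrix_of_enumerated_basis:
  fixes e :: "'k::finite \<Rightarrow> real^'n"
  assumes B: "orthonormal_basis V B" and e: "bij_betw e UNIV B"
  defines "X \<equiv> \<chi> i j. e j $ i"
  shows "orthonormal_basis_matrix V X"
proof -
  have col: "column j X = e j" for j
    by (simp add: X_def column_def vec_eq_iff)
  have eB: "e i \<in> B" and e_eq: "e i = e j \<longleftrightarrow> i = j" for i j
    using e by (auto simp: bij_betw_def inj_eq)
  have "(transpose X ** X) $ i $ j = column i X \<bullet> column j X" for i j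
    by (simp add: matrix_matrix_mult_def transpose_def column_def inner_vec_def)
  then have "(transpose X ** X) $ i $ j = mat 1 $ i $ j" for i j
    using orthonormal_basisD(5)[OF B eB] orthonormal_basisD(6)[OF B eB eB] e_eq
    by (simp add: mat_def norm_eq_1 col)
  then have "transpose X ** X = mat 1" unfolding vec_eq_iff by blast
  moreover have "columns X = B"
    using e by (auto simp: columns_def col bij_betw_def)
  ultimately show ?thesis
    using B by (simp add: orthonormal_basis_matrix_def orthonormal_columns_def column_space_def
        orthonormal_basis_def)
qed

lemma orthonormal_basis_matrix_exists:
  fixes V :: "(real^'n) set"
  assumes "subspace V" "dim V = CARD('k)"
  obtains X :: "real^'k^'n" where "orthonormal_basis_matrix V X"
proof -
  obtain B where B: "orthonormal_basis V B" using orthonormal_basis_exists assms(1) .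
  then obtain e :: "'k \<Rightarrow> real^'n" where "bij_betw e UNIV B"
    using finite_same_card_bij[of "UNIV :: 'k set" B] orthonormal_basisD(1,2)[OF B] assms(2) by auto
  from matrix_of_enumerated_basis[OF B this] show thesis by (rule that)
qed

section \<open>The chordal distance to a complement\<close>

lemma norm_transpose_mult_sq:
  fixes X :: "real^'k^'n"
  shows "(norm (transpose X *v y))\<^sup>2 = (\<Sum>j\<in>UNIV. (column j X \<bullet> y)\<^sup>2)"
proof -
  have "(transpose X *v y) $ j = column j X \<bullet> y" for j
    by (simp only: matrix_vector_mul_component) (simp add: transpose_def column_def)
  then show ?thesis
    unfolding power2_norm_eq_inner inner_vec_def[of "transpose X *v y"]
    by (simp add: power2_eq_square del: transpose_matrix_vector)
qed

text \<open>With \<open>M = X\<^sup>T Y\<close> and a singular basis \<open>B\<close> of \<open>M\<close>, each singular value \<open>\<parallel>M b\<parallel>\<close> is at most \<open>1\<close> and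
  contributes \<open>1 - \<parallel>M b\<parallel>\<^sup>2\<close>. The sum of the \<open>\<parallel>M b\<parallel>\<^sup>2\<close> is the squared Frobenius norm of \<open>M\<close>, by
  Parseval applied to the rows of \<open>M\<close>; its entries are the inner products of the columns.\<close>

lemma chordal_dist_matrix_eq:
  fixes X Y :: "real^'k^'n"
  assumes X: "orthonormal_columns X" and Y: "orthonormal_columns Y"
  shows "chordal_dist_matrix X Y
    = sqrt (\<Sum>i\<in>UNIV. 1 - (\<Sum>j\<in>UNIV. (column i X \<bullet> column j Y)\<^sup>2))"
proof -
  define M where "M = transpose X ** Y"
  obtain B where B: "orthonormal_basis UNIV B" "pairwise (\<lambda>b c. (M *v b) \<bullet> (M *v c) = 0) B"
    using singular_basis_exists[of "(*v) M" UNIV] by auto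
  note BD = orthonormal_basisD[OF B(1)]
  have le1: "norm (M *v b) \<le> 1" if "b \<in> B" for b
  proof -
    have "(norm (M *v b))\<^sup>2 = (\<Sum>c\<in>columns X. (c \<bullet> (Y *v b))\<^sup>2)"
      by (simp only: M_def matrix_vector_mul_assoc[symmetric] norm_transpose_mult_sq sum_columns[OF X])
    also have "\<dots> \<le> (norm (Y *v b))\<^sup>2"
      using bessel[OF orthonormal_basis_columns(1)[OF X], of "Y *v b"] by (simp add: inner_commute)
    also have "\<dots> = ((transpose Y ** Y) *v b) \<bullet> b"
      by (simp only: gram_matrix_inner power2_norm_eq_inner)
    also have "\<dots> = 1"
      using Y BD(5)[OF that] by (simp add: orthonormal_columns_def norm_eq_1)
    finally show ?thesis using power2_le_imp_le[of "norm (M *v b)" 1] by simp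
  qed
  have "(\<Sum>\<theta>\<in>#principal_angles X Y. (sin \<theta>)\<^sup>2) = (\<Sum>b\<in>B. (sin (arccos (norm (M *v b))))\<^sup>2)"
    unfolding principal_angles_def M_def[symmetric] singular_values_eq[OF B] sum_unfold_sum_mset
      multiset.map_comp o_def by (rule refl)
  also have "\<dots> = (\<Sum>b\<in>B. 1 - (norm (M *v b))\<^sup>2)"
  proof (intro sum.cong refl)
    fix b assume "b \<in> B"
    then have "cos (arccos (norm (M *v b))) = norm (M *v b)"
      using le1 order_trans[OF _ norm_ge_zero[of "M *v b"], of "- 1"] by (intro cos_arccos) auto
    then show "(sin (arccos (norm (M *v b))))\<^sup>2 = 1 - (norm (M *v b))\<^sup>2"
      by (simp only: sin_squared_eq)
  qed
  also have "\<dots> = CARD('k) - (\<Sum>b\<in>B. (norm (M *v b))\<^sup>2)"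
    using BD(2) by (simp add: sum_subtractf)
  also have "(\<Sum>b\<in>B. (norm (M *v b))\<^sup>2) = (\<Sum>b\<in>B. \<Sum>i\<in>UNIV. (M $ i \<bullet> b)\<^sup>2)"
    unfolding power2_norm_eq_inner inner_vec_def[of "M *v _"] matrix_vector_mul_component
    by (simp add: power2_eq_square)
  also have "\<dots> = (\<Sum>i\<in>UNIV. \<Sum>b\<in>B. (M $ i \<bullet> b)\<^sup>2)"
    by (rule sum.swap)
  also have "\<dots> = (\<Sum>i\<in>UNIV. (norm (M $ i))\<^sup>2)"
    using parseval[OF B(1)] by simp
  also have "\<dots> = (\<Sum>i\<in>UNIV. \<Sum>j\<in>UNIV. (column i X \<bullet> column j Y)\<^sup>2)"
  proof (intro sum.cong refl)
    have "M $ i $ j = column i X \<bullet> column j Y" for i j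
      by (simp add: M_def matrix_matrix_mult_def transpose_def column_def inner_vec_def)
    then show "(norm (M $ i))\<^sup>2 = (\<Sum>j\<in>UNIV. (column i X \<bullet> column j Y)\<^sup>2)" for i
      unfolding power2_norm_eq_inner inner_vec_def[of "M $ i"] by (simp add: power2_eq_square)
  qed
  finally have "(\<Sum>\<theta>\<in>#principal_angles X Y. (sin \<theta>)\<^sup>2)
      = CARD('k) - (\<Sum>i\<in>UNIV. \<Sum>j\<in>UNIV. (column i X \<bullet> column j Y)\<^sup>2)" .
  then show ?thesis
    unfolding chordal_dist_matrix_def sum_subtractf by simp
qed

text \<open>Bessel and Parseval for the columns of \<open>X\<close> with respect to the orthonormal system formed by \<open>C\<close> and
  the columns of \<open>Y\<close>.\<close>

lemma chordal_dist_matrix_orthogonal_bound: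
  fixes X Y :: "real^'k^'n"
  assumes X: "orthonormal_columns X" and Y: "orthonormal_columns Y"
    and C: "orthonormal_basis W C" and YW: "column_space Y \<subseteq> W\<^sup>\<bottom>"
  shows "sqrt (\<Sum>w\<in>C. (norm (transpose X *v w))\<^sup>2) \<le> chordal_dist_matrix X Y"
    and "(\<And>i. column i X \<in> span (C \<union> columns Y)) \<Longrightarrow>
      chordal_dist_matrix X Y = sqrt (\<Sum>w\<in>C. (norm (transpose X *v w))\<^sup>2)"
proof -
  note CY = orthonormal_basis_Un[OF C orthonormal_basis_columns(1)[OF Y] YW]
  have split: "(\<Sum>c\<in>C \<union> columns Y. (x \<bullet> c)\<^sup>2)
      = (\<Sum>w\<in>C. (x \<bullet> w)\<^sup>2) + (\<Sum>j\<in>UNIV. (x \<bullet> column j Y)\<^sup>2)" for x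
    using CY(2) orthonormal_basisD(1)[OF CY(1)]
    by (simp add: sum.union_disjoint sum_columns[OF Y])
  have norm1: "(norm (column i X))\<^sup>2 = 1" for i
    using orthonormal_columns_inner[OF X, of i i] by (simp add: power2_norm_eq_inner)
  have swap: "(\<Sum>w\<in>C. (norm (transpose X *v w))\<^sup>2) = (\<Sum>i\<in>UNIV. \<Sum>w\<in>C. (column i X \<bullet> w)\<^sup>2)"
    unfolding norm_transpose_mult_sq by (rule sum.swap)
  show "sqrt (\<Sum>w\<in>C. (norm (transpose X *v w))\<^sup>2) \<le> chordal_dist_matrix X Y"
    unfolding chordal_dist_matrix_eq[OF X Y] swap
  proof (intro real_sqrt_le_mono sum_mono)
    show "(\<Sum>w\<in>C. (column i X \<bullet> w)\<^sup>2) \<le> 1 - (\<Sum>j\<in>UNIV. (column i X \<bullet> column j Y)\<^sup>2)" for i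
      using bessel[OF CY(1), of "column i X"] by (simp add: split norm1)
  qed
  assume "\<And>i. column i X \<in> span (C \<union> columns Y)"
  then have "(\<Sum>w\<in>C. (column i X \<bullet> w)\<^sup>2) = 1 - (\<Sum>j\<in>UNIV. (column i X \<bullet> column j Y)\<^sup>2)" for i
    using parseval[OF CY(1), of "column i X"] by (simp add: split norm1)
  then show "chordal_dist_matrix X Y = sqrt (\<Sum>w\<in>C. (norm (transpose X *v w))\<^sup>2)"
    unfolding chordal_dist_matrix_eq[OF X Y] swap by simp
qed

text \<open>Supplies a nearest plane: with the columns of a basis matrix of a \<open>k\<close>-plane as the vectors \<open>x i\<close>, the
  subspace \<open>V\<close> attains equality in the preceding bound. It is the span of the projections of the \<open>x i\<close>
  to the complement of \<open>W\<close>, enlarged within that complement to dimension exactly \<open>k\<close>.\<close>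

lemma plane_capturing_vectors:
  fixes W :: "'a::euclidean_space set" and x :: "'i \<Rightarrow> 'a"
  assumes C: "orthonormal_basis W C" and I: "finite I" "card I \<le> k" and k: "dim W + k \<le> DIM('a)"
  obtains V where "subspace V" "dim V = k" "V \<subseteq> W\<^sup>\<bottom>" "\<And>i. i \<in> I \<Longrightarrow> x i \<in> span (C \<union> V)"
proof -
  define P where "P y = y - (\<Sum>c\<in>C. (c \<bullet> y) *\<^sub>R c)" for y
  note CD = orthonormal_basisD[OF C]
  let ?U = "span (P ` x ` I)"
  have "dim W + dim (W\<^sup>\<bottom>) = DIM('a)"
    using dim_orthogonal_comp_within[of UNIV W] CD(3) by simp
  then have kW: "k \<le> dim (W\<^sup>\<bottom>)" using k by simp
  have "orthogonal c (P y)" if "c \<in> C" for c y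
    unfolding orthogonal_def
  proof -
    have "c \<bullet> (\<Sum>d\<in>C. (d \<bullet> y) *\<^sub>R d) = (\<Sum>d\<in>C. if d = c then c \<bullet> y else 0)"
      unfolding inner_sum_right
      using CD(5,6) that by (intro sum.cong) (auto simp: norm_eq_1)
    then show "c \<bullet> P y = 0" using CD(1) that by (simp add: P_def inner_diff_right)
  qed
  then have "orthogonal c (P y)" if "c \<in> W" for c y
    using that C orthogonal_to_span[of c C "P y"]
    by (simp add: orthonormal_basis_def orthogonal_commute)
  then have UW: "?U \<subseteq> W\<^sup>\<bottom>"
    by (intro span_minimal subspace_orthogonal_comp) (auto simp: orthogonal_comp_def)
  have "dim ?U \<le> card (P ` x ` I)" using I(1) by (simp add: dim_le_card')
  also have "\<dots> \<le> k" using I card_image_le[of I "\<lambda>i. P (x i)"] by (simp add: image_image)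
  finally have Uk: "dim ?U \<le> k" .
  obtain B1 where B1: "orthonormal_basis ?U B1"
    using orthonormal_basis_exists[OF subspace_span] .
  \<comment> \<open>The span of the projections may have dimension less than \<open>k\<close>; \<open>B2'\<close> fills it up.\<close>
  obtain B2 where B2: "orthonormal_basis (W\<^sup>\<bottom> \<inter> ?U\<^sup>\<bottom>) B2"
    using orthonormal_basis_exists[OF subspace_inter[OF subspace_orthogonal_comp subspace_orthogonal_comp]] .
  have "dim ?U + dim (W\<^sup>\<bottom> \<inter> ?U\<^sup>\<bottom>) = dim (W\<^sup>\<bottom>)"
    by (intro dim_orthogonal_comp_within subspace_orthogonal_comp subspace_span UW)
  then have "k - dim ?U \<le> card B2"
    using kW orthonormal_basisD(2)[OF B2] by simp
  then obtain B2' where B2': "B2' \<subseteq> B2" "card B2' = k - dim ?U" "finite B2'"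
    using obtain_subset_with_card_n by metis
  have "span B2' \<subseteq> ?U\<^sup>\<bottom>"
    using B2'(1) orthonormal_basisD(4)[OF B2] by (intro span_minimal subspace_orthogonal_comp) auto
  note B = orthonormal_basis_Un[OF B1 orthonormal_basis_span_subset[OF B2 B2'(1)] this]
  let ?V = "span (B1 \<union> B2')"
  show thesis
  proof (rule that[of ?V])
    show "dim ?V = k"
      using orthonormal_basisD(2)[OF B(1)] B(2) orthonormal_basisD(1,2)[OF B1] B2' Uk
      by (simp add: card_Un_disjoint)
    show "?V \<subseteq> W\<^sup>\<bottom>"
      using UW orthonormal_basisD(4)[OF B1] B2'(1) orthonormal_basisD(4)[OF B2]
      by (intro span_minimal subspace_orthogonal_comp) auto
    show "x i \<in> span (C \<union> ?V)" if "i \<in> I" for i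
    proof -
      have "P (x i) \<in> ?U" using that by (intro span_base) auto
      also have "?U \<subseteq> ?V" using B1 by (metis Un_upper1 orthonormal_basis_def span_mono)
      finally have "P (x i) \<in> span (C \<union> ?V)" by (intro span_base) auto
      moreover have "(\<Sum>c\<in>C. (c \<bullet> x i) *\<^sub>R c) \<in> span (C \<union> ?V)"
        by (intro span_sum span_scale span_base) auto
      ultimately have "P (x i) + (\<Sum>c\<in>C. (c \<bullet> x i) *\<^sub>R c) \<in> span (C \<union> ?V)"
        by (rule span_add)
      then show ?thesis by (simp add: P_def)
    qed
  qed (rule subspace_span)
qed

lemma chordal_dist_to_complement_eq:
  fixes X :: "real^'k^'n"
  assumes X: "orthonormal_basis_matrix S X" and C: "orthonormal_basis W C"
    and W: "dim W + CARD('k) \<le> CARD('n)"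
  shows "chordal_dist_to_complement TYPE('k) S W = sqrt (\<Sum>w\<in>C. (norm (transpose X *v w))\<^sup>2)"
  unfolding chordal_dist_to_complement_def
proof (rule Least_equality)
  have oX: "orthonormal_columns X" using X by (simp add: orthonormal_basis_matrix_def)
  obtain V where V: "subspace V" "dim V = CARD('k)" "V \<subseteq> W\<^sup>\<bottom>"
      "\<And>i :: 'k. column i X \<in> span (C \<union> V)"
    using plane_capturing_vectors[OF C, of "UNIV :: 'k set" "CARD('k)" "\<lambda>i. column i X"] W by auto
  obtain Y :: "real^'k^'n" where Y: "orthonormal_basis_matrix V Y"
    using orthonormal_basis_matrix_exists[OF V(1,2)] .
  then have oY: "orthonormal_columns Y" and sY: "column_space Y = V"
    by (auto simp: orthonormal_basis_matrix_def)
  have "C \<union> V \<subseteq> span (C \<union> columns Y)"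
    using sY span_mono[of "columns Y" "C \<union> columns Y"] span_superset[of "C \<union> columns Y"]
    by (auto simp: column_space_def)
  then have "span (C \<union> V) \<subseteq> span (C \<union> columns Y)"
    by (intro span_minimal subspace_span)
  then have "\<And>i. column i X \<in> span (C \<union> columns Y)" using V(4) by blast
  then have "chordal_dist_matrix X Y = sqrt (\<Sum>w\<in>C. (norm (transpose X *v w))\<^sup>2)"
    using V(3) sY by (intro chordal_dist_matrix_orthogonal_bound(2)[OF oX oY C]) simp_all
  then have "sqrt (\<Sum>w\<in>C. (norm (transpose X *v w))\<^sup>2) = chordal_dist TYPE('k) S V"
    unfolding chordal_dist_eq[OF X Y] by (rule sym)
  moreover have "V \<in> planes_orthogonal_to CARD('k) W"
    using V(1-3) by (simp add: planes_orthogonal_to_def grassmannian_def)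
  ultimately show "\<exists>Y\<in>planes_orthogonal_to CARD('k) W.
      sqrt (\<Sum>w\<in>C. (norm (transpose X *v w))\<^sup>2) = chordal_dist TYPE('k) S Y"
    by blast
next
  fix r assume "\<exists>Y\<in>planes_orthogonal_to CARD('k) W. r = chordal_dist TYPE('k) S Y"
  then obtain V where V: "subspace V" "dim V = CARD('k)" "V \<subseteq> W\<^sup>\<bottom>"
    and r: "r = chordal_dist TYPE('k) S V"
    by (auto simp: planes_orthogonal_to_def grassmannian_def)
  obtain Y :: "real^'k^'n" where Y: "orthonormal_basis_matrix V Y"
    using orthonormal_basis_matrix_exists[OF V(1,2)] .
  show "sqrt (\<Sum>w\<in>C. (norm (transpose X *v w))\<^sup>2) \<le> r"
    unfolding r chordal_dist_eq[OF X Y]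
    using X Y V(3) C by (intro chordal_dist_matrix_orthogonal_bound(1))
      (auto simp: orthonormal_basis_matrix_def)
qed

text \<open>The rows of the transposed concatenation are the columns of all the \<open>X i\<close>, so its value at \<open>w\<close>
  has squared length \<open>\<Sum>\<^sub>i \<parallel>X\<^sub>i\<^sup>T w\<parallel>\<^sup>2\<close>.\<close>

lemma sum_sq_chordal_dist_eq:
  fixes X :: "'d::finite \<Rightarrow> real^'k^'n"
  assumes X: "\<And>i. orthonormal_basis_matrix (S i) (X i)" and C: "orthonormal_basis W C"
    and W: "dim W + CARD('k) \<le> CARD('n)"
  shows "sum_sq_chordal_dist TYPE('k) S W
    = (\<Sum>w\<in>C. (norm (transpose (concat_matrices X) *v w))\<^sup>2)"
proof -
  have col: "column c (concat_matrices X) = column (snd c) (X (fst c))" for c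
    by (simp add: column_def concat_matrices_def)
  have "(norm (transpose (concat_matrices X) *v w))\<^sup>2
      = (\<Sum>i\<in>UNIV. (norm (transpose (X i) *v w))\<^sup>2)" for w
    unfolding norm_transpose_mult_sq col
    by (simp add: sum.cartesian_product case_prod_beta flip: UNIV_Times_UNIV)
  then have "(\<Sum>w\<in>C. (norm (transpose (concat_matrices X) *v w))\<^sup>2)
      = (\<Sum>i\<in>UNIV. \<Sum>w\<in>C. (norm (transpose (X i) *v w))\<^sup>2)"
    by simp (rule sum.swap)
  then show ?thesis
    by (simp add: sum_sq_chordal_dist_def chordal_dist_to_complement_eq[OF X C W] sum_nonneg
        del: transpose_matrix_vector)
qed

section \<open>Minimizers and their matrices\<close>

lemma is_arg_min_grassmannian_iff:
  fixes A :: "real^'n^'m" and F :: "(real^'n) set \<Rightarrow> real"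
  assumes F: "\<And>V B. dim V = p \<Longrightarrow> orthonormal_basis V B \<Longrightarrow> F V = (\<Sum>b\<in>B. (norm (A *v b))\<^sup>2)"
    and p: "p \<le> CARD('n)"
  shows "is_arg_min F (\<lambda>V. V \<in> grassmannian p) W
    \<longleftrightarrow> (\<exists>vs. ordered_right_singular_basis A vs \<and> W = span (set (take p vs)))"
proof
  assume min: "is_arg_min F (\<lambda>V. V \<in> grassmannian p) W"
  then have W: "subspace W" "dim W = p" by (auto simp: is_arg_min_def grassmannian_def)
  have "F V = (\<Sum>b\<in>B. (norm (A *v b))\<^sup>2)" if "dim V = dim W" "orthonormal_basis V B" for V B
    using F[OF _ that(2)] that(1) W(2) by simp
  moreover have "F W \<le> F V" if "subspace V" "dim V = dim W" for V
    using min that W(2) unfolding is_arg_min_linorder grassmannian_def by blast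
  ultimately obtain vs where "ordered_right_singular_basis A vs" "W = span (set (take (dim W) vs))"
    by (rule minimizer_is_smallest_singular_span[OF W(1)])
  then show "\<exists>vs. ordered_right_singular_basis A vs \<and> W = span (set (take p vs))"
    unfolding W(2) by blast
next
  assume "\<exists>vs. ordered_right_singular_basis A vs \<and> W = span (set (take p vs))"
  then obtain vs where vs: "ordered_right_singular_basis A vs" and W: "W = span (set (take p vs))"
    by blast
  note T = take_singular_basis[OF vs p, folded W]
  show "is_arg_min F (\<lambda>V. V \<in> grassmannian p) W"
    unfolding is_arg_min_linorder
  proof (intro conjI allI impI)
    show "W \<in> grassmannian p" using T(2) by (simp add: W grassmannian_def)
    fix V :: "(real^'n) set" assume "V \<in> grassmannian p"
    then have V: "subspace V" "dim V = p" by (auto simp: grassmannian_def)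
    obtain C where C: "orthonormal_basis V C" using orthonormal_basis_exists[OF V(1)] .
    show "F W \<le> F V"
      unfolding F[OF T(2,1)] F[OF V(2) C]
      using smallest_singular_span_minimal[OF vs C] unfolding V(2) .
  qed
qed

lemma column_space_orthonormal_columns:
  "column_space ` {W :: real^'p^'n. orthonormal_columns W} = grassmannian CARD('p)"
proof (intro equalityI subsetI)
  fix V :: "(real^'n) set" assume "V \<in> grassmannian CARD('p)"
  then obtain X :: "real^'p^'n" where "orthonormal_basis_matrix V X"
    using orthonormal_basis_matrix_exists[of V] by (auto simp: grassmannian_def)
  then show "V \<in> column_space ` {W :: real^'p^'n. orthonormal_columns W}"
    by (auto simp: orthonormal_basis_matrix_def)
next
  fix V :: "(real^'n) set" assume "V \<in> column_space ` {W :: real^'p^'n. orthonormal_columns W}"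
  then show "V \<in> grassmannian CARD('p)"
    using orthonormal_basis_columns(2) orthonormal_basis_columns(1)[THEN orthonormal_basisD(3)]
    by (auto simp: grassmannian_def)
qed

lemma is_arg_min_column_space:
  fixes W :: "real^'p^'n" and F :: "(real^'n) set \<Rightarrow> real"
  assumes "orthonormal_columns W"
  shows "is_arg_min (\<lambda>W'. F (column_space W')) orthonormal_columns W
    \<longleftrightarrow> is_arg_min F (\<lambda>V. V \<in> grassmannian CARD('p)) (column_space W)"
proof -
  have "(\<forall>V. V \<in> grassmannian CARD('p) \<longrightarrow> F (column_space W) \<le> F V)
      \<longleftrightarrow> (\<forall>W' :: real^'p^'n. orthonormal_columns W' \<longrightarrow> F (column_space W) \<le> F (column_space W'))"
    unfolding column_space_orthonormal_columns[where 'p='p, symmetric] image_iff by auto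
  moreover have "column_space W \<in> grassmannian CARD('p)"
    using assms unfolding column_space_orthonormal_columns[where 'p='p, symmetric] by simp
  ultimately show ?thesis
    unfolding is_arg_min_linorder using assms by simp
qed

lemma column_space_smallest_right_singular_matrix:
  fixes V :: "real^'p^'n" and A :: "real^'n^'m"
  assumes vs: "ordered_right_singular_basis A vs" and p: "CARD('p) \<le> CARD('n)"
    and f: "bij_betw f (UNIV :: 'p set) {..<CARD('p)}" "\<And>j. column j V = vs ! f j"
  shows "orthonormal_basis_matrix (span (set (take CARD('p) vs))) V"
proof -
  note R = ordered_right_singular_basisD[OF vs]
  note T = take_singular_basis(1)[OF vs p]
  have "bij_betw (\<lambda>i. vs ! i) {..<CARD('p)} (set (take CARD('p) vs))"
    using p R(1,5)
    by (auto simp: bij_betw_def inj_on_def nth_eq_iff_index_eq set_conv_nth)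
      (metis nth_take imageI lessThan_iff)
  from bij_betw_trans[OF f(1) this]
  have "bij_betw (\<lambda>j. column j V) UNIV (set (take CARD('p) vs))"
    by (simp add: o_def f(2))
  from matrix_of_enumerated_basis[OF T this] show ?thesis
    by (simp add: column_def)
qed

text \<open>The freedom of choosing \<open>Q\<close> is exactly the freedom of choosing an orthonormal basis of the column
  space, so this passes from matrices to subspaces.\<close>

lemma span_smallest_iff_right_singular_matrix:
  fixes W :: "real^'p^'n" and A :: "real^'n^'m"
  assumes W: "orthonormal_columns W" and p: "CARD('p) \<le> CARD('n)"
  shows "(\<exists>vs. ordered_right_singular_basis A vs \<and> column_space W = span (set (take CARD('p) vs)))
    \<longleftrightarrow> (\<exists>Q. orthogonal_matrix Q \<and> smallest_right_singular_matrix A (W ** Q))"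
    (is "?L \<longleftrightarrow> ?R")
proof
  assume ?L
  then obtain vs where vs: "ordered_right_singular_basis A vs"
    and cW: "column_space W = span (set (take CARD('p) vs))" by blast
  obtain f where f: "bij_betw f (UNIV :: 'p set) {..<CARD('p)}"
    using finite_same_card_bij[of "UNIV :: 'p set" "{..<CARD('p)}"] by auto
  define V :: "real^'p^'n" where "V = (\<chi> i j. (vs ! f j) $ i)"
  have col: "column j V = vs ! f j" for j by (simp add: V_def column_def vec_eq_iff)
  have "orthonormal_basis_matrix (column_space W) W" "orthonormal_basis_matrix (column_space W) V"
    using W column_space_smallest_right_singular_matrix[OF vs p f col]
    unfolding cW[symmetric] by (simp_all add: orthonormal_basis_matrix_def)
  then obtain Q where "orthogonal_matrix Q" "V = W ** Q" by (rule orthonormal_basis_change)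
  then show ?R using vs f col by (auto simp: smallest_right_singular_matrix_def)
next
  assume ?R
  then obtain Q vs f where Q: "orthogonal_matrix Q" and vs: "ordered_right_singular_basis A vs"
    and f: "bij_betw f (UNIV :: 'p set) {..<CARD('p)}" "\<And>j. column j (W ** Q) = vs ! f j"
    by (auto simp: smallest_right_singular_matrix_def)
  have WQ: "orthonormal_basis_matrix (span (set (take CARD('p) vs))) (W ** Q)"
    by (rule column_space_smallest_right_singular_matrix[OF vs p f])
  have "columns (W ** Q) \<subseteq> column_space W"
  proof
    fix v assume "v \<in> columns (W ** Q)"
    then obtain j where "v = W *v (Q *v axis j 1)"
      by (auto simp: columns_def matrix_vector_mult_basis[symmetric] matrix_vector_mul_assoc)
    then show "v \<in> column_space W"
      by (simp only: column_space_def matrix_vector_mult_in_columnspace)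
  qed
  then have sub: "span (set (take CARD('p) vs)) \<subseteq> column_space W"
    using WQ span_minimal[of "columns (W ** Q)" "column_space W"]
    by (simp add: orthonormal_basis_matrix_def column_space_def)
  then have "span (set (take CARD('p) vs)) = column_space W"
    using take_singular_basis(2)[OF vs p] orthonormal_basis_columns(2)[OF W]
    by (intro subspace_dim_equal) (auto simp: column_space_def)
  with vs show ?L by auto
qed

theorem proposition3:
  fixes S :: "'d::finite \<Rightarrow> (real^'n) set"
    and X :: "'d \<Rightarrow> real^'k^'n"
  assumes "\<And>i. S i \<in> grassmannian CARD('k)"
    and "\<And>i. orthonormal_basis_matrix (S i) (X i)"
    and "CARD('k) + CARD('p) \<le> CARD('n)"
  defines "A \<equiv> transpose (concat_matrices X)"
  shows
    "(\<forall>W :: real^'p^'n. orthonormal_columns W \<longrightarrow>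
        (is_arg_min (\<lambda>W'. sum_sq_chordal_dist TYPE('k) S (column_space W')) orthonormal_columns W
         \<longleftrightarrow> (\<exists>Q. orthogonal_matrix Q \<and> smallest_right_singular_matrix A (W ** Q))))
     \<and>
     (\<forall>W :: real^'p^'n.
        is_arg_min (\<lambda>W'. sum_sq_chordal_dist TYPE('k) S (column_space W')) orthonormal_columns W \<longrightarrow>
        sqrt (sum_sq_chordal_dist TYPE('k) S (column_space W))
          = L2_set (\<lambda>i. sorted_singular_values A ! i) {..<CARD('p)})
     \<and>
     (\<forall>vs. ordered_right_singular_basis A vs \<longrightarrow>
        (\<forall>p'. CARD('k) \<le> p' \<and> p' \<le> CARD('n) \<longrightarrow>
           is_arg_min (sum_sq_chordal_dist TYPE('k) S) (\<lambda>W. W \<in> grassmannian (CARD('n) - p'))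
             (span (set (take (CARD('n) - p') vs)))) \<and>
        (\<forall>p' q'. CARD('k) \<le> p' \<and> p' \<le> q' \<and> q' \<le> CARD('n) \<longrightarrow>
           planes_orthogonal_to CARD('k) (span (set (take (CARD('n) - p') vs)))
           \<subseteq> planes_orthogonal_to CARD('k) (span (set (take (CARD('n) - q') vs)))))"
proof -
  let ?F = "sum_sq_chordal_dist TYPE('k) S"
  have F: "?F V = (\<Sum>b\<in>B. (norm (A *v b))\<^sup>2)"
    if "dim V + CARD('k) \<le> CARD('n)" "orthonormal_basis V B" for V B
    unfolding A_def by (rule sum_sq_chordal_dist_eq[OF assms(2) that(2,1)])
  have subspaces: "is_arg_min ?F (\<lambda>V. V \<in> grassmannian m) W
      \<longleftrightarrow> (\<exists>vs. ordered_right_singular_basis A vs \<and> W = span (set (take m vs)))"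
    if "m + CARD('k) \<le> CARD('n)" for m W
    using that by (intro is_arg_min_grassmannian_iff F) auto
  have p: "CARD('p) + CARD('k) \<le> CARD('n)" "CARD('p) \<le> CARD('n)" using assms(3) by auto
  have matrices: "is_arg_min (\<lambda>W'. ?F (column_space W')) orthonormal_columns W
      \<longleftrightarrow> (\<exists>vs. ordered_right_singular_basis A vs \<and> column_space W = span (set (take CARD('p) vs)))"
    if "orthonormal_columns W" for W :: "real^'p^'n"
    using is_arg_min_column_space[OF that] subspaces[OF p(1)] by simp
  show ?thesis
  proof (intro conjI allI impI)
    fix W :: "real^'p^'n" assume W: "orthonormal_columns W"
    show "is_arg_min (\<lambda>W'. ?F (column_space W')) orthonormal_columns W
         \<longleftrightarrow> (\<exists>Q. orthogonal_matrix Q \<and> smallest_right_singular_matrix A (W ** Q))"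
      unfolding matrices[OF W] by (rule span_smallest_iff_right_singular_matrix[OF W p(2)])
  next
    fix W :: "real^'p^'n"
    assume min: "is_arg_min (\<lambda>W'. ?F (column_space W')) orthonormal_columns W"
    then have "orthonormal_columns W" by (simp add: is_arg_min_def)
    then obtain vs where vs: "ordered_right_singular_basis A vs"
      "column_space W = span (set (take CARD('p) vs))"
      using matrices min by blast
    note T = take_singular_basis[OF vs(1) p(2), folded vs(2)]
    show "sqrt (?F (column_space W)) = L2_set (\<lambda>i. sorted_singular_values A ! i) {..<CARD('p)}"
      using F[OF _ T(1)] T(2,3) p(1) by (simp add: L2_set_def)
  next
    fix vs p' assume "ordered_right_singular_basis A vs" "CARD('k) \<le> p' \<and> p' \<le> CARD('n)"
    then show "is_arg_min ?F (\<lambda>W. W \<in> grassmannian (CARD('n) - p'))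
        (span (set (take (CARD('n) - p') vs)))"
      using subspaces[of "CARD('n) - p'"] by auto
  next
    fix vs :: "(real^'n) list" and p' q' assume "CARD('k) \<le> p' \<and> p' \<le> q' \<and> q' \<le> CARD('n)"
    then have "span (set (take (CARD('n) - q') vs)) \<subseteq> span (set (take (CARD('n) - p') vs))"
      by (intro span_mono set_take_subset_set_take) auto
    from orthogonal_comp_anti_mono[OF this]
    show "planes_orthogonal_to CARD('k) (span (set (take (CARD('n) - p') vs)))
        \<subseteq> planes_orthogonal_to CARD('k) (span (set (take (CARD('n) - q') vs)))"
      by (auto simp: planes_orthogonal_to_def)
  qed
qed

end
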